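(* Let $N,H$ be positive integers, let $R,\lambda,T>0$ and $\alpha\in(0,1]$, and put $\mu=\lambda T$ and $\eta=H/N$. Let $\mathbf{s}_n$ be the service time of a packet in the efficient mode of the time-based packetization policy, i.e. $\mathbf{s}_n=\mathbf{r}_n(H+\mathbf{k}_nN)/R$, where $(\mathbf{k}_n,\mathbf{r}_n)$ has joint law $$\mathbb{P}(\mathbf{k}_n=k,\mathbf{r}_n=r)=\frac{\alpha^{H+kN}\left(1-\alpha^{H+kN}\right)^{r-1}}{1-e^{-\mu}}\,e^{-\mu}\frac{\mu^k}{k!},\qquad k,r\in\{1,2,3,\dots\}.$$ Then $$\mathbb{E}[\mathbf{s}_n]=\frac{Ne^{-\mu}}{(1-e^{-\mu})R\alpha^{H}}\Big[(\eta+\mu\alpha^{-N})e^{\mu\alpha^{-N}}-\eta\Big]$$ and $$\mathbb{E}[\mathbf{s}_n^2]=\frac{N^2e^{-\mu}}{(1-e^{-\mu})R^2\alpha^{H}}\Big[\big(2\mu\alpha^{-2N}+2\mu^2\alpha^{-4N}+4\eta\mu\alpha^{-2N}+2\eta^2\big)\alpha^{-H}e^{\mu\alpha^{-2N}}-\big(\mu\alpha^{-N}+\mu^2\alpha^{-2N}+2\eta\mu\alpha^{-N}+\eta^2\big)e^{\mu\alpha^{-N}}+\eta^2\big(1-2\alpha^{-H}\big)\Big].$$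
   Context: Model: symbols of $N$ bits arrive according to a Poisson process of rate $\lambda$. Time is partitioned into intervals of length $T$. In the efficient mode, the symbols arriving in an interval are bundled, together with an $H$-bit header, into one packet; no packet is formed for an interval with no arrivals. Hence the number $\mathbf{k}_n$ of symbols in a packet is a Poisson($\mu$) variable, $\mu=\lambda T$, conditioned to be nonzero, and the packet length is $\mathbf{l}_n=H+\mathbf{k}_nN$ bits. Packets are sent over a channel of rate $R$ bits per second with bit success probability $\alpha=1-\beta$ ($\beta$ is the bit error probability). A packet is repeated until all its bits are received correctly, so, given $\mathbf{k}_n=k$, the number of transmissions $\mathbf{r}_n$ is geometric on $\{1,2,\dots\}$ with success probability $\alpha^{H+kN}$ (convention $0^0=1$ when $\alpha=1$). The service time is the total transmission time $\mathbf{s}_n=\mathbf{r}_n\mathbf{l}_n/R$. *)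

theory Defs
  imports "HOL-Probability.Probability"
begin

end

theory Submission imports Defs begin

section \<open>Series\<close>

text \<open>Given k = i, the number of transmissions is geometric with success probability p_i =
  \<alpha>^(H + i N), so its first two moments are 1/p_i and 2/p_i^2 - 1/p_i
  (\<open>geometric_law_moments\<close>). Now 1/p_i = \<alpha>^(-H) (\<alpha>^(-N))^i is exponential
  in i. Averaging against the Poisson weights \<mu>^i / i! therefore merely rescales \<mu> to \<mu>
  \<alpha>^(-N) or \<mu> \<alpha>^(-2N), and since the packet length is N (\<eta> + i), what remains
  are exponential series weighted by \<eta> + i or its square (\<open>exp_series_moments\<close>).
  They start at i = 1, as no packet is empty; the missing term at 0 produces the subtracted \<eta>
  and \<eta>^2. All terms are nonnegative, so the expectation is an iterated sum over the joint law,
  and its finiteness also yields integrability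
  (\<open>has_bochner_integral_pair_pos_nat\<close>).\<close>

lemma geometric_square_sums:
  fixes z :: real
  assumes "\<bar>z\<bar> < 1"
  shows "(\<lambda>n. (real (Suc n))\<^sup>2 * z ^ n) sums ((1 + z) / (1 - z) ^ 3)"
proof -
  have z: "norm z < 1" "norm \<bar>z\<bar> < 1" using assms by auto
  have d: "(\<lambda>n. real (Suc n) * z ^ n) sums (1 / (1 - z)\<^sup>2)"
    using geometric_deriv_sums[OF z(1)] by simp
  \<comment> \<open>The Cauchy product needs absolute convergence, which is the same series taken at
    the absolute value of z.\<close>
  have dn: "summable (\<lambda>n. norm (real (Suc n) * z ^ n))"
    using sums_summable[OF geometric_deriv_sums[OF z(2)]]
    by (simp add: abs_mult power_abs)
  have gn: "summable (\<lambda>n. norm (z ^ n))"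
    using assms by (simp add: power_abs summable_geometric)
  \<comment> \<open>Convolving the coefficients n + 1 with the constant 1 gives the triangular
    numbers (n + 1)(n + 2)/2. The squares then come from (n + 1)^2 = (n + 1)(n + 2) - (n +
    1).\<close>
  have "(\<lambda>n. \<Sum>i\<le>n. (real (Suc i) * z ^ i) * z ^ (n - i)) sums
      ((\<Sum>n. real (Suc n) * z ^ n) * (\<Sum>n. z ^ n))"
    by (rule Cauchy_product_sums[OF dn gn])
  moreover have "(\<Sum>i\<le>n. (real (Suc i) * z ^ i) * z ^ (n - i)) =
      (real (Suc n) * (real n + 2) / 2) * z ^ n" for n
  proof -
    have "(\<Sum>i\<le>n. (real (Suc i) * z ^ i) * z ^ (n - i)) = (\<Sum>i\<le>n. real (Suc i)) * z ^ n"
      unfolding sum_distrib_right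
      by (rule sum.cong) (auto simp: mult.assoc simp flip: power_add)
    also have "(\<Sum>i\<le>n. real (Suc i)) = real (Suc n) * (real n + 2) / 2"
      by (induction n) (auto simp: field_simps)
    finally show ?thesis .
  qed
  moreover have "(\<Sum>n. real (Suc n) * z ^ n) = 1 / (1 - z)\<^sup>2"
    using d by (rule sums_unique[symmetric])
  moreover have "(\<Sum>n. z ^ n) = 1 / (1 - z)"
    using geometric_sums[OF z(1)] by (rule sums_unique[symmetric])
  ultimately have "(\<lambda>n. (real (Suc n) * (real n + 2) / 2) * z ^ n) sums
      (1 / (1 - z)\<^sup>2 * (1 / (1 - z)))"
    by (simp only:)
  from sums_diff[OF sums_mult[OF this, of 2] d]
  moreover have "2 * ((real (Suc n) * (real n + 2) / 2) * z ^ n) - real (Suc n) * z ^ n =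
      (real (Suc n))\<^sup>2 * z ^ n" for n
    by (simp add: algebra_simps add_divide_distrib power2_eq_square)
  ultimately
  have "(\<lambda>n. (real (Suc n))\<^sup>2 * z ^ n) sums
      (2 * (1 / (1 - z)\<^sup>2 * (1 / (1 - z))) - 1 / (1 - z)\<^sup>2)"
    by (simp only:)
  moreover have "2 * (1 / (1 - z)\<^sup>2 * (1 / (1 - z))) - 1 / (1 - z)\<^sup>2 = (1 + z) / (1 - z) ^ 3"
  proof -
    have "1 - z \<noteq> 0" using assms by auto
    then show ?thesis by (simp add: divide_simps power2_eq_square power3_eq_cube)
  qed
  ultimately show ?thesis by simp
qed

text \<open>Power series at 1 - p, with j counting failures and \<open>Suc j\<close> transmissions.
  The case p = 1 (error-free channel) is covered because 0^0 = 1.\<close>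

lemma geometric_law_moments:
  fixes p :: real
  assumes "0 < p" "p \<le> 1"
  shows "(\<lambda>j. p * (1 - p) ^ j) sums 1"
    and "(\<lambda>j. p * (1 - p) ^ j * real (Suc j)) sums (1 / p)"
    and "(\<lambda>j. p * (1 - p) ^ j * (real (Suc j))\<^sup>2) sums (2 / p\<^sup>2 - 1 / p)"
proof -
  have z: "norm (1 - p) < 1" using assms by auto
  show "(\<lambda>j. p * (1 - p) ^ j) sums 1"
    using sums_mult[OF geometric_sums[OF z], of p] assms by simp
  show "(\<lambda>j. p * (1 - p) ^ j * real (Suc j)) sums (1 / p)"
    using sums_mult[OF geometric_deriv_sums[OF z], of p] assms
    by (simp add: mult_ac power2_eq_square)
  have "p * ((1 + (1 - p)) / (1 - (1 - p)) ^ 3) = 2 / p\<^sup>2 - 1 / p"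
    using assms by (simp add: field_simps power2_eq_square power3_eq_cube)
  then show "(\<lambda>j. p * (1 - p) ^ j * (real (Suc j))\<^sup>2) sums (2 / p\<^sup>2 - 1 / p)"
    using sums_mult[OF geometric_square_sums, of "1 - p" p] z by (simp add: mult_ac)
qed

text \<open>A factor i cancels against i!, leaving x times the previous term of the exponential
  series; this reduces each polynomial weight to the series of \<open>exp\<close>. The index starts
  at 1, whence the subtracted 1, c and c^2.\<close>

lemma exp_series_moments:
  fixes x c :: real
  shows "(\<lambda>i. x ^ Suc i / fact (Suc i)) sums (exp x - 1)"
    and "(\<lambda>i. (c + real (Suc i)) * (x ^ Suc i / fact (Suc i))) sums ((c + x) * exp x - c)"
    and "(\<lambda>i. (c + real (Suc i))\<^sup>2 * (x ^ Suc i / fact (Suc i))) sums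
      ((x + x\<^sup>2 + 2 * c * x + c\<^sup>2) * exp x - c\<^sup>2)"
proof -
  have e: "(\<lambda>i. x ^ i / fact i) sums exp x"
    using exp_converges[of x] by (simp add: field_simps)
  show s0: "(\<lambda>i. x ^ Suc i / fact (Suc i)) sums (exp x - 1)"
    using e by (subst sums_Suc_iff) simp
  have c1: "real (Suc i) * (x ^ Suc i / fact (Suc i)) = x * (x ^ i / fact i)" for i
    by (simp add: field_simps del: of_nat_Suc)
  have s1: "(\<lambda>i. real (Suc i) * (x ^ Suc i / fact (Suc i))) sums (x * exp x)"
    unfolding c1 by (rule sums_mult[OF e])
  \<comment> \<open>Restoring index 0 costs nothing, since the weight vanishes there.\<close>
  then have s1': "(\<lambda>i. real i * (x ^ i / fact i)) sums (x * exp x)"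
    by (subst (asm) sums_Suc_iff) simp
  \<comment> \<open>One of the two factors cancels by \<open>c1\<close>; the other is split as i +
    1, which leads back to \<open>s1'\<close> and \<open>e\<close>.\<close>
  have c2: "(real (Suc i))\<^sup>2 * (x ^ Suc i / fact (Suc i)) =
      x * (real i * (x ^ i / fact i) + x ^ i / fact i)" for i
  proof -
    have "(real (Suc i))\<^sup>2 * (x ^ Suc i / fact (Suc i)) =
        real (Suc i) * (real (Suc i) * (x ^ Suc i / fact (Suc i)))"
      by (simp only: power2_eq_square mult.assoc)
    also have "\<dots> = real (Suc i) * (x * (x ^ i / fact i))" by (simp only: c1)
    also have "\<dots> = x * (real i * (x ^ i / fact i) + x ^ i / fact i)"
      by (simp add: algebra_simps add_divide_distrib)
    finally show ?thesis .
  qed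
  have s2: "(\<lambda>i. (real (Suc i))\<^sup>2 * (x ^ Suc i / fact (Suc i))) sums
      (x * (x * exp x + exp x))"
    unfolding c2 by (intro sums_mult sums_add s1' e)
  have "(\<lambda>i. c * (x ^ Suc i / fact (Suc i)) + real (Suc i) * (x ^ Suc i / fact (Suc i))) sums
      (c * (exp x - 1) + x * exp x)"
    by (intro sums_mult sums_add s0 s1)
  then show "(\<lambda>i. (c + real (Suc i)) * (x ^ Suc i / fact (Suc i))) sums ((c + x) * exp x - c)"
    by (simp only: ring_distribs) (simp add: algebra_simps)
  have "(\<lambda>i. c\<^sup>2 * (x ^ Suc i / fact (Suc i)) + 2 * c * (real (Suc i) * (x ^ Suc i / fact (Suc i)))
        + (real (Suc i))\<^sup>2 * (x ^ Suc i / fact (Suc i))) sums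
      (c\<^sup>2 * (exp x - 1) + 2 * c * (x * exp x) + x * (x * exp x + exp x))"
    by (intro sums_mult sums_add s0 s1 s2)
  also have "(\<lambda>i. c\<^sup>2 * (x ^ Suc i / fact (Suc i)) + 2 * c * (real (Suc i) * (x ^ Suc i / fact (Suc i)))
        + (real (Suc i))\<^sup>2 * (x ^ Suc i / fact (Suc i))) =
      (\<lambda>i. (c + real (Suc i))\<^sup>2 * (x ^ Suc i / fact (Suc i)))"
    unfolding power2_sum by (intro ext) (simp only: ring_distribs mult_ac add_ac)
  also have "c\<^sup>2 * (exp x - 1) + 2 * c * (x * exp x) + x * (x * exp x + exp x) =
      (x + x\<^sup>2 + 2 * c * x + c\<^sup>2) * exp x - c\<^sup>2"
    by (simp add: algebra_simps power2_eq_square)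
  finally show "(\<lambda>i. (c + real (Suc i))\<^sup>2 * (x ^ Suc i / fact (Suc i))) sums
      ((x + x\<^sup>2 + 2 * c * x + c\<^sup>2) * exp x - c\<^sup>2)" .
qed

section \<open>Expectations of functions of a pair of random naturals\<close>

text \<open>At each point exactly one indicator in the double sum is nonzero, so the integrand is a
  countable sum of simple functions; monotone convergence allows termwise integration in
  \<open>ennreal\<close> without any summability condition.\<close>

lemma nn_integral_pair_nat:
  fixes k r :: "'a \<Rightarrow> nat"
  assumes [measurable]: "k \<in> measurable M (count_space UNIV)"
    "r \<in> measurable M (count_space UNIV)"
  shows "(\<integral>\<^sup>+\<omega>. f (k \<omega>) (r \<omega>) \<partial>M) =
    (\<Sum>i. \<Sum>j. emeasure M {\<omega> \<in> space M. k \<omega> = i \<and> r \<omega> = j} * f i j)"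
proof -
  have pick: "(\<Sum>n. if n = m then g n else 0) = g m" for m :: nat and g :: "nat \<Rightarrow> ennreal"
    using sums_single[of m g] by (rule sums_unique[symmetric])
  have "f (k \<omega>) (r \<omega>) =
      (\<Sum>i. \<Sum>j. f i j * indicator {\<omega> \<in> space M. k \<omega> = i \<and> r \<omega> = j} \<omega>)"
    if "\<omega> \<in> space M" for \<omega>
  proof -
    have "(\<Sum>j. f i j * indicator {\<omega> \<in> space M. k \<omega> = i \<and> r \<omega> = j} \<omega>) =
        (if i = k \<omega> then f i (r \<omega>) else 0)" for i
    proof -
      have "(\<Sum>j. f i j * indicator {\<omega> \<in> space M. k \<omega> = i \<and> r \<omega> = j} \<omega>) =
          (\<Sum>j. if j = r \<omega> then (if i = k \<omega> then f i j else 0) else 0)"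
        using that by (intro suminf_cong) (auto simp: indicator_def)
      then show ?thesis by (simp add: pick)
    qed
    then show ?thesis by (simp add: pick)
  qed
  then have "(\<integral>\<^sup>+\<omega>. f (k \<omega>) (r \<omega>) \<partial>M) =
      (\<integral>\<^sup>+\<omega>. (\<Sum>i. \<Sum>j. f i j * indicator {\<omega> \<in> space M. k \<omega> = i \<and> r \<omega> = j} \<omega>) \<partial>M)"
    by (intro nn_integral_cong) simp
  also have "\<dots> = (\<Sum>i. \<Sum>j. f i j * emeasure M {\<omega> \<in> space M. k \<omega> = i \<and> r \<omega> = j})"
    by (simp add: nn_integral_suminf nn_integral_cmult_indicator)
  finally show ?thesis by (simp add: mult.commute)
qed

context prob_space
begin

text \<open>The law is only prescribed at positive pairs; since it has total mass 1 there, the pairs with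
  a zero entry form a null event.\<close>

lemma has_bochner_integral_pair_pos_nat:
  fixes k r :: "'a \<Rightarrow> nat" and f :: "nat \<Rightarrow> nat \<Rightarrow> real"
  assumes k [measurable]: "k \<in> measurable M (count_space UNIV)"
    and r [measurable]: "r \<in> measurable M (count_space UNIV)"
    and law: "\<And>i j. prob {\<omega> \<in> space M. k \<omega> = Suc i \<and> r \<omega> = Suc j} = P i j"
    and P: "\<And>i. P i sums a i" "a sums 1"
    and f: "\<And>i j. 0 \<le> f i j"
    and I: "\<And>i. (\<lambda>j. P i j * f (Suc i) (Suc j)) sums b i" "b sums I"
  shows "has_bochner_integral M (\<lambda>\<omega>. f (k \<omega>) (r \<omega>)) I"
proof -
  have P_nonneg: "0 \<le> P i j" for i j
    using law[of i j] measure_nonneg[of M] by metis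
  \<comment> \<open>The mask removes the pairs about which \<open>law\<close> says nothing. The
    claim serves twice: with g = 1 it gives mass 1 to the positive pairs, and with g = f it gives
    the value sought.\<close>
  have pos_part: "(\<integral>\<^sup>+\<omega>. (if 0 < k \<omega> \<and> 0 < r \<omega> then ennreal (g (k \<omega>) (r \<omega>)) else 0) \<partial>M) = ennreal J"
    if g: "\<And>i j. 0 \<le> g i j" and J: "\<And>i. (\<lambda>j. P i j * g (Suc i) (Suc j)) sums c i" "c sums J"
    for g c J
  proof -
    let ?G = "\<lambda>i j. emeasure M {\<omega> \<in> space M. k \<omega> = i \<and> r \<omega> = j} *
        (if 0 < i \<and> 0 < j then ennreal (g i j) else 0)"
    have c: "0 \<le> c i" for i
      using J(1)[of i] g P_nonneg by (intro sums_le[OF _ sums_zero J(1)]) auto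
    \<comment> \<open>The mask makes the terms at index 0 vanish, so both sums can be reindexed by
      \<open>Suc\<close> to match P.\<close>
    have shift: "(\<Sum>i. h i) = (\<Sum>i. h (Suc i))" if "h 0 = 0" for h :: "nat \<Rightarrow> ennreal"
    proof (rule sums_unique[symmetric])
      show "h sums (\<Sum>i. h (Suc i))"
        using sums_Suc[OF summable_sums[OF summableI, of "\<lambda>i. h (Suc i)"]] that by simp
    qed
    have "(\<Sum>j. ?G (Suc i) j) = ennreal (c i)" for i
    proof -
      have "(\<Sum>j. ?G (Suc i) j) = (\<Sum>j. ?G (Suc i) (Suc j))" by (rule shift) simp
      also have "\<dots> = (\<Sum>j. ennreal (P i j * g (Suc i) (Suc j)))"
        using P_nonneg g by (simp add: emeasure_eq_measure law ennreal_mult)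
      also have "\<dots> = ennreal (c i)"
        using P_nonneg g J(1) by (intro suminf_ennreal_eq) auto
      finally show ?thesis .
    qed
    then have "(\<Sum>i. \<Sum>j. ?G i j) = (\<Sum>i. ennreal (c i))"
      by (subst shift) simp_all
    also have "\<dots> = ennreal J" using c J(2) by (rule suminf_ennreal_eq)
    finally show ?thesis
      using nn_integral_pair_nat[OF k r, of "\<lambda>i j. if 0 < i \<and> 0 < j then ennreal (g i j) else 0"]
      by simp
  qed
  have "(\<integral>\<^sup>+\<omega>. (if 0 < k \<omega> \<and> 0 < r \<omega> then ennreal 1 else 0) \<partial>M) = ennreal 1"
    using P by (intro pos_part[of "\<lambda>_ _. 1"]) auto
  moreover have "(\<integral>\<^sup>+\<omega>. (if 0 < k \<omega> \<and> 0 < r \<omega> then ennreal 1 else 0) \<partial>M) =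
      (\<integral>\<^sup>+\<omega>. indicator {\<omega> \<in> space M. 0 < k \<omega> \<and> 0 < r \<omega>} \<omega> \<partial>M)"
    by (intro nn_integral_cong) (auto simp: indicator_def)
  ultimately have "prob {\<omega> \<in> space M. 0 < k \<omega> \<and> 0 < r \<omega>} = 1"
    by (simp add: emeasure_eq_measure)
  then have pos: "AE \<omega> in M. 0 < k \<omega> \<and> 0 < r \<omega>"
    by (subst (asm) prob_Collect_eq_1) auto
  have "(\<integral>\<^sup>+\<omega>. ennreal (f (k \<omega>) (r \<omega>)) \<partial>M) =
      (\<integral>\<^sup>+\<omega>. (if 0 < k \<omega> \<and> 0 < r \<omega> then ennreal (f (k \<omega>) (r \<omega>)) else 0) \<partial>M)"
    using pos by (intro nn_integral_cong_AE) auto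
  also have "\<dots> = ennreal I" using f I by (rule pos_part)
  finally have "(\<integral>\<^sup>+\<omega>. ennreal (f (k \<omega>) (r \<omega>)) \<partial>M) = ennreal I" .
  moreover have "0 \<le> b i" for i
    using f P_nonneg by (intro sums_le[OF _ sums_zero I(1)]) auto
  then have "0 \<le> I" by (intro sums_le[OF _ sums_zero I(2)]) auto
  moreover have "(\<lambda>\<omega>. f (k \<omega>) (r \<omega>)) \<in> borel_measurable M" by measurable
  ultimately show ?thesis
    using f by (intro has_bochner_integral_nn_integral) auto
qed

end

section \<open>First two moments of the service time\<close>

theorem mainTheorem1:
  fixes N H :: nat and R lam T \<alpha> \<mu> \<eta> :: real
    and M :: "'a measure" and k r :: "'a \<Rightarrow> nat" and s :: "'a \<Rightarrow> real"
  assumes "N > 0" and "H > 0"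
    and "R > 0" and "lam > 0" and "T > 0"
    and "0 < \<alpha>" and "\<alpha> \<le> 1"
    and "\<mu> = lam * T" and "\<eta> = real H / real N"
    and "prob_space M"
    and "k \<in> measurable M (count_space UNIV)"
    and "r \<in> measurable M (count_space UNIV)"
    and joint_law: "\<And>i j. i \<ge> 1 \<Longrightarrow> j \<ge> 1 \<Longrightarrow>
          measure M {\<omega> \<in> space M. k \<omega> = i \<and> r \<omega> = j} =
            \<alpha> ^ (H + i * N) * (1 - \<alpha> ^ (H + i * N)) ^ (j - 1) / (1 - exp (- \<mu>))
              * (exp (- \<mu>) * (\<mu> ^ i / fact i))"
    and "\<And>\<omega>. \<omega> \<in> space M \<Longrightarrow>
          s \<omega> = real (r \<omega>) * (real H + real (k \<omega>) * real N) / R"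
  shows "integrable M s \<and> integrable M (\<lambda>\<omega>. (s \<omega>)\<^sup>2) \<and>
    (\<integral>\<omega>. s \<omega> \<partial>M) =
      real N * exp (- \<mu>) / ((1 - exp (- \<mu>)) * R * \<alpha> ^ H)
        * ((\<eta> + \<mu> * \<alpha> powi (- int N)) * exp (\<mu> * \<alpha> powi (- int N)) - \<eta>) \<and>
    (\<integral>\<omega>. (s \<omega>)\<^sup>2 \<partial>M) =
      (real N)\<^sup>2 * exp (- \<mu>) / ((1 - exp (- \<mu>)) * R\<^sup>2 * \<alpha> ^ H)
        * ((2 * \<mu> * \<alpha> powi (- 2 * int N) + 2 * \<mu>\<^sup>2 * \<alpha> powi (- 4 * int N)
              + 4 * \<eta> * \<mu> * \<alpha> powi (- 2 * int N) + 2 * \<eta>\<^sup>2)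
             * \<alpha> powi (- int H) * exp (\<mu> * \<alpha> powi (- 2 * int N))
           - (\<mu> * \<alpha> powi (- int N) + \<mu>\<^sup>2 * \<alpha> powi (- 2 * int N)
              + 2 * \<eta> * \<mu> * \<alpha> powi (- int N) + \<eta>\<^sup>2) * exp (\<mu> * \<alpha> powi (- int N))
           + \<eta>\<^sup>2 * (1 - 2 * \<alpha> powi (- int H)))"
proof -
  interpret prob_space M by fact
  have \<mu>: "0 < \<mu>" using assms by simp
  \<comment> \<open>C normalizes the Poisson law truncated at 0. The weights \<open>w i\<close> and
    success probabilities \<open>p i\<close> belong to packets of \<open>Suc i\<close> symbols,
    while a and h stand for \<alpha>^(-N) and \<alpha>^(-H).\<close>
  define C where "C = exp (- \<mu>) / (1 - exp (- \<mu>))"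
  have C: "C * (exp \<mu> - 1) = 1"
    using \<mu> by (simp add: C_def field_simps exp_minus)
  define w where "w i = C * (\<mu> ^ Suc i / fact (Suc i))" for i
  define p where "p i = \<alpha> ^ (H + Suc i * N)" for i
  define a where "a = inverse (\<alpha> ^ N)"
  define h where "h = inverse (\<alpha> ^ H)"
  have p: "0 < p i" "p i \<le> 1" for i
    using \<open>0 < \<alpha>\<close> \<open>\<alpha> \<le> 1\<close> by (simp_all add: p_def power_le_one)
  \<comment> \<open>The mean number of transmissions is geometric in the packet size; this keeps the
    later series exponential.\<close>
  have inv_p: "1 / p i = h * a ^ Suc i" for i
    unfolding p_def a_def h_def power_add mult.commute[of _ N] power_mult divide_inverse
      inverse_mult_distrib power_inverse by simp
  let ?l = "\<lambda>i. real H + real i * real N"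
  have l: "?l i = real N * (\<eta> + real i)" for i
    using \<open>N > 0\<close> by (simp add: \<open>\<eta> = real H / real N\<close> field_simps)
  note law_rule = has_bochner_integral_pair_pos_nat[OF
      \<open>k \<in> measurable M (count_space UNIV)\<close> \<open>r \<in> measurable M (count_space UNIV)\<close>,
      where P = "\<lambda>i j. w i * (p i * (1 - p i) ^ j)" and a = w]
  have law: "prob {\<omega> \<in> space M. k \<omega> = Suc i \<and> r \<omega> = Suc j} = w i * (p i * (1 - p i) ^ j)" for i j
    by (subst joint_law) (simp_all add: w_def p_def C_def)
  have w_row: "(\<lambda>j. w i * (p i * (1 - p i) ^ j)) sums w i" for i
    using sums_mult[OF geometric_law_moments(1)[OF p], of "w i" i] by simp
  have w_sum: "w sums 1"
    using sums_mult[OF exp_series_moments(1)[of \<mu>], of C] unfolding w_def C .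

  let ?E1 = "C * real N / R * h * ((\<eta> + \<mu> * a) * exp (\<mu> * a) - \<eta>)"
  have s1: "has_bochner_integral M (\<lambda>\<omega>. real (r \<omega>) * ?l (k \<omega>) / R) ?E1"
  proof (rule law_rule[where f = "\<lambda>i j. real j * ?l i / R"
        and b = "\<lambda>i. w i * ?l (Suc i) / R * (1 / p i)"])
    show "(\<lambda>j. w i * (p i * (1 - p i) ^ j) * (real (Suc j) * ?l (Suc i) / R)) sums
        (w i * ?l (Suc i) / R * (1 / p i))" for i
      using sums_mult[OF geometric_law_moments(2)[OF p], of "w i * ?l (Suc i) / R" i]
      by (simp add: mult_ac)
    \<comment> \<open>The power of a from \<open>inv_p\<close> is absorbed into the Poisson weight,
      turning \<mu> into \<mu> a.\<close>
    have "w i * ?l (Suc i) / R * (1 / p i) = C * real N / R * h *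
        ((\<eta> + real (Suc i)) * ((\<mu> * a) ^ Suc i / fact (Suc i)))" for i
      unfolding w_def l inv_p power_mult_distrib by (simp only: divide_inverse mult_ac)
    then show "(\<lambda>i. w i * ?l (Suc i) / R * (1 / p i)) sums ?E1"
      by (simp only:) (intro sums_mult exp_series_moments)
  qed (use law w_row w_sum \<open>R > 0\<close> in auto)

  \<comment> \<open>\<open>?F\<close> is the sum of the exponential series with weight (\<eta> +
    i)^2. In \<open>?E2\<close>, the part 2/p^2 of the second geometric moment contributes the
    argument \<mu> a^2 with factor 2 h^2, and the part 1/p contributes \<mu> a with factor
    h.\<close>
  let ?F = "\<lambda>x. (x + x\<^sup>2 + 2 * \<eta> * x + \<eta>\<^sup>2) * exp x - \<eta>\<^sup>2"
  let ?E2 = "C * (real N)\<^sup>2 / R\<^sup>2 * (2 * h\<^sup>2 * ?F (\<mu> * a\<^sup>2) - h * ?F (\<mu> * a))"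
  have s2: "has_bochner_integral M (\<lambda>\<omega>. (real (r \<omega>) * ?l (k \<omega>) / R)\<^sup>2) ?E2"
  proof (rule law_rule[where f = "\<lambda>i j. (real j * ?l i / R)\<^sup>2"
        and b = "\<lambda>i. w i * (?l (Suc i) / R)\<^sup>2 * (2 / (p i)\<^sup>2 - 1 / p i)"])
    show "(\<lambda>j. w i * (p i * (1 - p i) ^ j) * (real (Suc j) * ?l (Suc i) / R)\<^sup>2) sums
        (w i * (?l (Suc i) / R)\<^sup>2 * (2 / (p i)\<^sup>2 - 1 / p i))" for i
      using sums_mult[OF geometric_law_moments(3)[OF p], of "w i * (?l (Suc i) / R)\<^sup>2" i]
      by (simp add: mult_ac power_mult_distrib power_divide)
    have "w i * (?l (Suc i) / R)\<^sup>2 * (2 / (p i)\<^sup>2 - 1 / p i) = C * (real N)\<^sup>2 / R\<^sup>2 *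
        (2 * h\<^sup>2 * ((\<eta> + real (Suc i))\<^sup>2 * ((\<mu> * a\<^sup>2) ^ Suc i / fact (Suc i)))
          - h * ((\<eta> + real (Suc i))\<^sup>2 * ((\<mu> * a) ^ Suc i / fact (Suc i))))" for i
    proof -
      have "2 / (p i)\<^sup>2 = 2 * (1 / p i)\<^sup>2" by (simp add: power_divide)
      also have "\<dots> = 2 * h\<^sup>2 * (a\<^sup>2) ^ Suc i"
        unfolding inv_p by (simp only: power_mult_distrib power_commutes mult.assoc
            flip: power_mult) (simp only: mult.commute)
      finally have "2 / (p i)\<^sup>2 = 2 * h\<^sup>2 * (a\<^sup>2) ^ Suc i" .
      then show ?thesis
        unfolding w_def l inv_p power_mult_distrib power_divide
        by (simp only: divide_inverse right_diff_distrib mult_ac)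
    qed
    then show "(\<lambda>i. w i * (?l (Suc i) / R)\<^sup>2 * (2 / (p i)\<^sup>2 - 1 / p i)) sums ?E2"
      by (simp only:) (intro sums_mult sums_diff exp_series_moments)
  qed (use law w_row w_sum in auto)

  \<comment> \<open>\<open>s\<close> is prescribed on \<open>space M\<close> only, which is all that
    the integral sees.\<close>
  have s: "s \<omega> = real (r \<omega>) * ?l (k \<omega>) / R" if "\<omega> \<in> space M" for \<omega>
    using assms that by blast
  have S1: "has_bochner_integral M s ?E1"
    using s1 by (rule has_bochner_integral_cong[THEN iffD1, rotated 3]) (simp_all add: s)
  have S2: "has_bochner_integral M (\<lambda>\<omega>. (s \<omega>)\<^sup>2) ?E2"
    using s2 by (rule has_bochner_integral_cong[THEN iffD1, rotated 3]) (simp_all add: s)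

  have powi: "\<alpha> powi (- int N) = a" "\<alpha> powi (- int H) = h"
    "\<alpha> powi (- 2 * int N) = a\<^sup>2" "\<alpha> powi (- 4 * int N) = a ^ 4"
  proof -
    have "\<alpha> powi (- (int m * int N)) = a ^ m" for m
      using power_int_of_nat[of \<alpha> "m * N"]
      by (simp add: power_int_minus a_def power_inverse mult.commute[of m] mult.commute[of "int m"] flip: power_mult)
    from this[of 1] this[of 2] this[of 4]
    show "\<alpha> powi (- int N) = a" "\<alpha> powi (- 2 * int N) = a\<^sup>2" "\<alpha> powi (- 4 * int N) = a ^ 4"
      by simp_all
    show "\<alpha> powi (- int H) = h" by (simp add: power_int_minus h_def)
  qed
  have E1: "?E1 = real N * exp (- \<mu>) / ((1 - exp (- \<mu>)) * R * \<alpha> ^ H)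
      * ((\<eta> + \<mu> * a) * exp (\<mu> * a) - \<eta>)"
    by (simp add: C_def h_def divide_inverse mult_ac)
  \<comment> \<open>One factor h moves into the prefactor; the one left beside the first
    \<open>?F\<close> is the inner \<alpha>^(-H). The constants - \<eta>^2 of the two
    \<open>?F\<close> combine to \<eta>^2 (1 - 2 h).\<close>
  have "?E2 = C * (real N)\<^sup>2 / R\<^sup>2 * h * (2 * h * ?F (\<mu> * a\<^sup>2) - ?F (\<mu> * a))"
    by (simp add: algebra_simps power2_eq_square)
  also have "C * (real N)\<^sup>2 / R\<^sup>2 * h =
      (real N)\<^sup>2 * exp (- \<mu>) / ((1 - exp (- \<mu>)) * R\<^sup>2 * \<alpha> ^ H)"
    by (simp add: C_def h_def divide_inverse mult_ac)
  also have "2 * h * ?F (\<mu> * a\<^sup>2) - ?F (\<mu> * a) =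
      (2 * \<mu> * a\<^sup>2 + 2 * \<mu>\<^sup>2 * a ^ 4 + 4 * \<eta> * \<mu> * a\<^sup>2 + 2 * \<eta>\<^sup>2) * h * exp (\<mu> * a\<^sup>2)
      - (\<mu> * a + \<mu>\<^sup>2 * a\<^sup>2 + 2 * \<eta> * \<mu> * a + \<eta>\<^sup>2) * exp (\<mu> * a) + \<eta>\<^sup>2 * (1 - 2 * h)"
    by algebra
  finally show ?thesis
    unfolding powi using S1 S2 E1 by (simp add: has_bochner_integral_iff)
qed

end
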